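(* Let $d\ge1$ and $K\geq 2$ be integers and $\sigma>0$. Let $\overline{\rho}^0\in\mathcal{P}(\mathbb{R}^d)$, let $\overline{\rho}^{n+1}=T[\overline{\rho}^n]$ for $n\ge0$, and assume that $\int_{\mathbb{R}^d}\bm{x}\,\overline{\rho}^n(d\bm{x})=\bm{0}$ for all $n\ge 0$. Then $$\mathcal{W}_2^2(\overline{\rho}^{n+1},\overline{\rho}_\infty)\leq\frac1K\,\mathcal{W}_2^2(\overline{\rho}^n,\overline{\rho}_\infty)\qquad\text{for all } n\ge0.$$ In particular, if $\mathcal{W}_2^2(\overline{\rho}^0,\overline{\rho}_\infty)<\infty$, then $\lim_{n\to\infty}\mathcal{W}_2^2(\overline{\rho}^n,\overline{\rho}_\infty)=0$.
   Context: Let $\mathcal{P}(\mathbb{R}^d)$ be the set of probability measures on $\mathbb{R}^d$ and $\mathbb{I}_d$ the $d\times d$ identity matrix. The operator $T:\mathcal{P}(\mathbb{R}^d)\to\mathcal{P}(\mathbb{R}^d)$ is $T[\rho]=\phi*S_K[C_K[\rho]]$, where $\phi$ is the density of $\mathcal{N}(\bm{0},\sigma^2\mathbb{I}_d)$, $C_K[\rho]=\rho*\cdots*\rho$ ($K$ times), and $S_K[\rho](\bm{x})=K^d\rho(K\bm{x})$ (for a measure: the push-forward under $\bm{x}\mapsto \bm{x}/K$). Equivalently, $T[\rho]$ is the law of $\frac1K\sum_{j=1}^K Y_j+W$ with $Y_1,\dots,Y_K$ i.i.d. of law $\rho$ and $W\sim\mathcal{N}(\bm{0},\sigma^2\mathbb{I}_d)$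 independent of them. $\overline{\rho}_\infty$ is the law $\mathcal{N}(\bm{0},\sigma_\infty^2\mathbb{I}_d)$, with density $\overline{\rho}_\infty(\bm{x})=(2\pi\sigma_\infty^2)^{-d/2}e^{-|\bm{x}|^2/(2\sigma_\infty^2)}$, where $\sigma_\infty^2=\frac{K}{K-1}\sigma^2$. $\mathcal{W}_2^2(\mu,\nu)=\inf\mathbb{E}[|X-Y|^2]\in[0,\infty]$, the infimum being over all couplings $(X,Y)$ with $X\sim\mu$ and $Y\sim\nu$. *)

theory Defs
  imports "HOL-Probability.Probability"
begin

definition prob_measures :: "'a::topological_space measure set" where
  "prob_measures = {\<mu>. prob_space \<mu> \<and> sets \<mu> = sets borel}"

text \<open>The centred isotropic Gaussian law; \<open>v\<close> is the variance of each coordinate,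
  not the standard deviation.\<close>

definition gaussian_density :: "real \<Rightarrow> real^'d \<Rightarrow> real" where
  "gaussian_density v x =
     (2 * pi * v) powr (- real CARD('d) / 2) * exp (- (norm x)\<^sup>2 / (2 * v))"

definition gaussian :: "real \<Rightarrow> (real^'d) measure" where
  "gaussian v = density lborel (\<lambda>x. ennreal (gaussian_density v x))"

text \<open>For \<open>K \<ge> 1\<close>, \<open>K\<close> factors \<open>\<rho>\<close> are convolved by \<open>K - 1\<close> convolutions.
  (For \<open>K = 0\<close> truncated subtraction gives \<open>\<rho>\<close>; this case is not used.)\<close>

definition conv_power :: "nat \<Rightarrow> (real^'d) measure \<Rightarrow> (real^'d) measure" where
  "conv_power K \<rho> = ((\<lambda>\<mu>. \<rho> \<star> \<mu>) ^^ (K - 1)) \<rho>"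

definition rescale :: "nat \<Rightarrow> (real^'d) measure \<Rightarrow> (real^'d) measure" where
  "rescale K \<rho> = distr \<rho> borel (\<lambda>x. x /\<^sub>R real K)"

definition T_op :: "nat \<Rightarrow> real \<Rightarrow> (real^'d) measure \<Rightarrow> (real^'d) measure" where
  "T_op K \<sigma> \<rho> = (gaussian (\<sigma>\<^sup>2) \<star> rescale K (conv_power K \<rho>))"

definition rho_inf :: "nat \<Rightarrow> real \<Rightarrow> (real^'d) measure" where
  "rho_inf K \<sigma> = gaussian (real K / (real K - 1) * \<sigma>\<^sup>2)"

text \<open>A coupling \<open>(X, Y)\<close> is represented by its joint law on the product space.\<close>

definition couplings :: "(real^'d) measure \<Rightarrow> (real^'d) measure \<Rightarrow> ((real^'d) \<times> (real^'d)) measure set" where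
  "couplings \<mu> \<nu> = {\<gamma> \<in> prob_measures. distr \<gamma> borel fst = \<mu> \<and> distr \<gamma> borel snd = \<nu>}"

definition W2_sq :: "(real^'d) measure \<Rightarrow> (real^'d) measure \<Rightarrow> ennreal" where
  "W2_sq \<mu> \<nu> = (INF \<gamma>\<in>couplings \<mu> \<nu>. \<integral>\<^sup>+(x, y). ennreal ((norm (x - y))\<^sup>2) \<partial>\<gamma>)"

end

theory Submission
  imports Defs
begin

text \<open>
  The stationary law is a fixed point of the operator: the average of \<open>K\<close> independent
  \<open>N(0, v)\<close> vectors has variance \<open>v / K\<close>, and \<open>v / K + \<sigma>\<^sup>2 = v\<close> is solved exactly by
  \<open>v = K / (K - 1) * \<sigma>\<^sup>2\<close> (\<open>T_op_rho_inf\<close>). So the contraction estimate for the orbit is an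
  instance of a Lipschitz estimate for the operator applied to two laws with equal means
  (\<open>W2_sq_T_op_le\<close>).

  That estimate comes from coupling. Take independent copies \<open>(X\<^sub>j, Y\<^sub>j)\<close> of a coupling of the
  two laws and use the same noise \<open>W\<close> on both sides. The difference of the two outputs is
  \<open>(1 / K) * (\<Sum>j. X\<^sub>j - Y\<^sub>j)\<close>. The summands are independent and centred, so the expected squared
  norms add up: the cost is \<open>1 / K\<^sup>2\<close> times \<open>K\<close> times the cost of one pair, that is, the original
  cost divided by \<open>K\<close>.

  On the level of laws, independent sums are convolutions. If \<open>\<gamma>\<close> couples \<open>\<mu>\<close> and \<open>\<nu>\<close> and \<open>\<gamma>'\<close>
  couples \<open>\<mu>'\<close> and \<open>\<nu>'\<close>, then \<open>\<gamma> \<star> \<gamma>'\<close>, a convolution on the product space, couples the two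
  convolutions, and its cost is the sum of the costs when \<open>\<mu>\<close> and \<open>\<nu>\<close> have equal means and the
  cost of \<open>\<gamma>\<close> is finite
  (\<open>transport_cost_convolution\<close>). Hence the squared distance is subadditive under convolution
  (\<open>W2_sq_convolution_le\<close>); this gives the factor \<open>K\<close> for the convolution power, and shows that
  convolving both sides with the same Gaussian costs nothing. Rescaling gives the factor
  \<open>1 / K\<^sup>2\<close>.
\<close>

section \<open>Gaussian laws\<close>

lemma nn_integral_lborel_affine:
  fixes f :: "'a::euclidean_space \<Rightarrow> ennreal"
  assumes [measurable]: "f \<in> borel_measurable borel" and c: "c \<noteq> 0"
  shows "(\<integral>\<^sup>+x. f x \<partial>lborel) = ennreal (\<bar>c\<bar> ^ DIM('a)) * (\<integral>\<^sup>+x. f (t + c *\<^sub>R x) \<partial>lborel)"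
  by (subst lborel_affine[OF c, of t])
     (simp add: nn_integral_density nn_integral_distr nn_integral_cmult)

lemma gaussian_density_nonneg [simp]: "0 \<le> gaussian_density v x"
  by (simp add: gaussian_density_def)

lemma borel_measurable_gaussian_density [measurable]:
  "gaussian_density v \<in> borel_measurable borel"
  unfolding gaussian_density_def[abs_def] by measurable

lemma sets_gaussian [simp, measurable_cong]: "sets (gaussian v) = sets borel"
  by (simp add: gaussian_def)

lemma nn_integral_gaussian:
  assumes [measurable]: "f \<in> borel_measurable borel"
  shows "(\<integral>\<^sup>+x. f x \<partial>gaussian v) = (\<integral>\<^sup>+x. ennreal (gaussian_density v x) * f x \<partial>lborel)"
  by (simp add: gaussian_def nn_integral_density)

text \<open>Independence of the coordinates reduces the normalising constant to the one-dimensional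
  case.\<close>

lemma gaussian_density_eq_prod:
  fixes x :: "real^'d"
  assumes "v > 0"
  shows "gaussian_density v x = (\<Prod>b\<in>Basis. normal_density 0 (sqrt v) (x \<bullet> b))"
proof -
  have "(\<Prod>b\<in>(Basis::(real^'d) set). normal_density 0 (sqrt v) (x \<bullet> b))
      = (1 / sqrt (2 * pi * v)) ^ CARD('d) * exp (\<Sum>b\<in>(Basis::(real^'d) set). - (x \<bullet> b)\<^sup>2 / (2 * v))"
    using assms by (simp add: normal_density_def prod_dividef exp_sum power_divide)
  also have "(\<Sum>b\<in>(Basis::(real^'d) set). - (x \<bullet> b)\<^sup>2 / (2 * v)) = - (norm x)\<^sup>2 / (2 * v)"
    unfolding power2_norm_eq_inner
    by (simp add: euclidean_inner[of x x] power2_eq_square sum_negf sum_divide_distrib)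
  also have "(1 / sqrt (2 * pi * v)) ^ CARD('d) = (2 * pi * v) powr (- real CARD('d) / 2)"
    using assms
    by (simp add: powr_half_sqrt[symmetric] powr_minus_divide[symmetric] powr_realpow[symmetric] powr_powr)
  finally show ?thesis
    by (simp add: gaussian_density_def)
qed

lemma nn_integral_gaussian_density:
  assumes "v > 0"
  shows "(\<integral>\<^sup>+x. ennreal (gaussian_density v x) \<partial>(lborel :: (real^'d) measure)) = 1"
proof -
  have "(\<integral>\<^sup>+x. ennreal (gaussian_density v x) \<partial>(lborel :: (real^'d) measure))
      = (\<integral>\<^sup>+x. (\<Prod>b\<in>Basis. ennreal (normal_density 0 (sqrt v) (x \<bullet> b))) \<partial>(lborel :: (real^'d) measure))"
    using assms by (simp add: gaussian_density_eq_prod prod_ennreal)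
  also have "\<dots> = (\<Prod>b\<in>(Basis::(real^'d) set). \<integral>\<^sup>+x. ennreal (normal_density 0 (sqrt v) x) \<partial>lborel)"
    by (rule nn_integral_lborel_prod) auto
  also have "\<dots> = 1"
    using assms by (simp add: nn_integral_eq_integral)
  finally show ?thesis .
qed

lemma prob_space_gaussian:
  assumes "v > 0"
  shows "prob_space (gaussian v :: (real^'d) measure)"
  using nn_integral_gaussian_density[OF assms, where 'd='d]
  by (intro prob_spaceI) (simp add: gaussian_def emeasure_density)

lemma gaussian_in_prob_measures: "v > 0 \<Longrightarrow> gaussian v \<in> prob_measures"
  by (simp add: prob_measures_def prob_space_gaussian)

text \<open>Completing the square in \<open>x\<close>. Probabilistically: if \<open>X \<sim> N(0, a)\<close> and \<open>Y - X \<sim> N(0, b)\<close> are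
  independent, the right-hand side factors their joint density into the density of \<open>Y\<close> and the
  conditional density of \<open>X\<close> given \<open>Y = y\<close>, a Gaussian with mean \<open>a / (a + b) * y\<close>. Integrating
  \<open>x\<close> out therefore leaves the density of \<open>Y\<close>, which is how Gaussians convolve.\<close>

lemma gaussian_density_mult:
  fixes x y :: "real^'d"
  assumes "a > 0" "b > 0"
  shows "gaussian_density a x * gaussian_density b (y - x)
       = gaussian_density (a + b) y * gaussian_density (a * b / (a + b)) (x - (a / (a + b)) *\<^sub>R y)"
proof -
  define c where "c = a * b / (a + b)"
  define p where "p = - real CARD('d) / 2"
  define X P Y where "X = x \<bullet> x" and "P = x \<bullet> y" and "Y = y \<bullet> y"
  have pos: "a + b > 0" "c > 0" using assms by (auto simp: c_def)
  have const: "(2 * pi * a) powr p * (2 * pi * b) powr p = (2 * pi * (a + b)) powr p * (2 * pi * c) powr p"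
    using assms pos by (simp add: powr_mult[symmetric]) (simp add: c_def mult_ac)
  have ny: "(norm y)\<^sup>2 = Y" and nx: "(norm x)\<^sup>2 = X"
    by (simp_all add: power2_norm_eq_inner X_def Y_def)
  have nyx: "(norm (y - x))\<^sup>2 = Y - 2 * P + X"
    by (simp add: power2_norm_eq_inner X_def Y_def P_def inner_diff inner_commute)
  have nd: "(norm (x - (a / (a + b)) *\<^sub>R y))\<^sup>2 = X - 2 * (a / (a + b)) * P + (a / (a + b))\<^sup>2 * Y"
    unfolding power2_norm_eq_inner X_def Y_def P_def
    by (simp add: inner_diff inner_commute power2_eq_square algebra_simps)
  have expo: "- (norm x)\<^sup>2 / (2 * a) + - (norm (y - x))\<^sup>2 / (2 * b)
     = - (norm y)\<^sup>2 / (2 * (a + b)) + - (norm (x - (a / (a + b)) *\<^sub>R y))\<^sup>2 / (2 * c)"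
    unfolding nx ny nyx nd c_def using assms pos(1)
    by (simp add: divide_simps power2_eq_square) algebra
  have "gaussian_density a x * gaussian_density b (y - x)
      = ((2 * pi * a) powr p * (2 * pi * b) powr p)
        * exp (- (norm x)\<^sup>2 / (2 * a) + - (norm (y - x))\<^sup>2 / (2 * b))"
    unfolding exp_add by (simp add: gaussian_density_def p_def)
  also have "\<dots> = gaussian_density (a + b) y * gaussian_density c (x - (a / (a + b)) *\<^sub>R y)"
    unfolding const expo exp_add by (simp add: gaussian_density_def p_def)
  finally show ?thesis by (simp add: c_def)
qed

lemma gaussian_convolution:
  assumes "a > 0" "b > 0"
  shows "(gaussian a \<star> gaussian b) = (gaussian (a + b) :: (real^'d) measure)"
proof (rule measure_eqI)
  fix A :: "(real^'d) set" assume "A \<in> sets (gaussian a \<star> gaussian b)"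
  then have [measurable]: "A \<in> sets borel" by simp
  have fin: "finite_measure (gaussian a :: (real^'d) measure)" "finite_measure (gaussian b :: (real^'d) measure)"
    using assms by (simp_all add: prob_space_gaussian prob_space.finite_measure)
  define c where "c = a * b / (a + b)"
  have c: "c > 0" using assms by (simp add: c_def)
  have "emeasure (gaussian a \<star> gaussian b) A
      = (\<integral>\<^sup>+x. \<integral>\<^sup>+y. indicator A (x + y) \<partial>gaussian b \<partial>gaussian a)"
    by (rule convolution_emeasure') (simp_all add: fin)
  also have "\<dots> = (\<integral>\<^sup>+x. ennreal (gaussian_density a x)
      * (\<integral>\<^sup>+y. ennreal (gaussian_density b y) * indicator A (x + y) \<partial>lborel) \<partial>lborel)"
    by (simp add: nn_integral_gaussian)
  also have "\<dots> = (\<integral>\<^sup>+x. ennreal (gaussian_density a x)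
      * (\<integral>\<^sup>+y. ennreal (gaussian_density b (y - x)) * indicator A y \<partial>lborel) \<partial>lborel)"
  proof -
    have "(\<integral>\<^sup>+y. ennreal (gaussian_density b y) * indicator A (x + y) \<partial>lborel)
        = (\<integral>\<^sup>+y. ennreal (gaussian_density b (y - x)) * indicator A y \<partial>lborel)" for x :: "real^'d"
      by (subst nn_integral_lborel_affine[of _ 1 "- x"]) simp_all
    then show ?thesis by simp
  qed
  also have "\<dots> = (\<integral>\<^sup>+x. \<integral>\<^sup>+y. ennreal (gaussian_density a x * gaussian_density b (y - x)) * indicator A y \<partial>lborel \<partial>lborel)"
    by (intro nn_integral_cong, subst nn_integral_cmult[symmetric]) (simp_all add: ennreal_mult' mult.assoc)
  also have "\<dots> = (\<integral>\<^sup>+y. \<integral>\<^sup>+x. ennreal (gaussian_density a x * gaussian_density b (y - x)) * indicator A y \<partial>lborel \<partial>lborel)"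
    by (rule lborel_pair.Fubini') simp
  also have "\<dots> = (\<integral>\<^sup>+y. (ennreal (gaussian_density (a + b) y) * indicator A y)
        * (\<integral>\<^sup>+x. ennreal (gaussian_density c (x - (a / (a + b)) *\<^sub>R y)) \<partial>lborel) \<partial>lborel)"
    unfolding gaussian_density_mult[OF assms] c_def[symmetric]
    by (intro nn_integral_cong, subst nn_integral_cmult[symmetric]) (simp_all add: ennreal_mult' mult_ac)
  also have "\<dots> = (\<integral>\<^sup>+y. ennreal (gaussian_density (a + b) y) * indicator A y \<partial>lborel)"
  proof (intro nn_integral_cong)
    fix y :: "real^'d"
    have "(\<integral>\<^sup>+x. ennreal (gaussian_density c (x - (a / (a + b)) *\<^sub>R y)) \<partial>lborel)
        = (\<integral>\<^sup>+x. ennreal (gaussian_density c x) \<partial>(lborel :: (real^'d) measure))"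
      by (subst (2) nn_integral_lborel_affine[of _ 1 "- ((a / (a + b)) *\<^sub>R y)"]) simp_all
    then show "(ennreal (gaussian_density (a + b) y) * indicator A y)
        * (\<integral>\<^sup>+x. ennreal (gaussian_density c (x - (a / (a + b)) *\<^sub>R y)) \<partial>lborel)
        = ennreal (gaussian_density (a + b) y) * indicator A y"
      using c by (simp add: nn_integral_gaussian_density)
  qed
  also have "\<dots> = emeasure (gaussian (a + b)) A"
    by (simp add: gaussian_def emeasure_density)
  finally show "emeasure (gaussian a \<star> gaussian b) A = emeasure (gaussian (a + b)) A" .
qed simp

lemma conv_power_1: "conv_power 1 \<rho> = \<rho>"
  by (simp add: conv_power_def)

lemma conv_power_Suc: "K \<ge> 1 \<Longrightarrow> conv_power (Suc K) \<rho> = (\<rho> \<star> conv_power K \<rho>)"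
  by (cases K) (simp_all add: conv_power_def)

lemma conv_power_gaussian:
  assumes "v > 0" "K \<ge> 1"
  shows "conv_power K (gaussian v) = gaussian (real K * v)"
  using assms(2)
proof (induction K rule: dec_induct)
  case base
  show ?case using conv_power_1[of "gaussian v"] by simp
next
  case (step K)
  then show ?case
    using assms(1) by (simp add: conv_power_Suc gaussian_convolution ring_distribs)
qed

lemma gaussian_density_scale:
  fixes x :: "real^'d"
  assumes "v > 0" "k > 0"
  shows "k ^ CARD('d) * gaussian_density v (k *\<^sub>R x) = gaussian_density (v / k\<^sup>2) x"
proof -
  have "2 * pi * (v / k\<^sup>2) = (2 * pi * v) * k powr (-2)"
    using assms by (simp add: powr_minus_divide)
  then have "(2 * pi * (v / k\<^sup>2)) powr (- real CARD('d) / 2)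
      = (2 * pi * v) powr (- real CARD('d) / 2) * (k powr (-2)) powr (- real CARD('d) / 2)"
    using assms
    by (simp only: powr_mult)
  also have "(k powr (-2)) powr (- real CARD('d) / 2) = k ^ CARD('d)"
    using assms by (simp add: powr_powr powr_realpow)
  finally show ?thesis
    using assms by (simp add: gaussian_density_def power_mult_distrib divide_simps mult_ac)
qed

lemma rescale_gaussian:
  assumes "v > 0" "K \<ge> 1"
  shows "rescale K (gaussian v) = (gaussian (v / (real K)\<^sup>2) :: (real^'d) measure)"
proof (rule measure_eqI)
  fix A :: "(real^'d) set" assume "A \<in> sets (rescale K (gaussian v))"
  then have [measurable]: "A \<in> sets borel" by (simp add: rescale_def)
  have K: "real K > 0" using assms by simp
  have "emeasure (rescale K (gaussian v)) A = (\<integral>\<^sup>+x. indicator A x \<partial>rescale K (gaussian v))"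
    by (simp add: rescale_def)
  also have "\<dots> = (\<integral>\<^sup>+x. ennreal (gaussian_density v x) * indicator A (x /\<^sub>R real K) \<partial>lborel)"
    unfolding rescale_def by (subst nn_integral_distr) (simp_all add: nn_integral_gaussian)
  also have "\<dots> = ennreal (real K ^ CARD('d))
      * (\<integral>\<^sup>+x. ennreal (gaussian_density v (real K *\<^sub>R x)) * indicator A x \<partial>lborel)"
    using K by (subst nn_integral_lborel_affine[of _ "real K" 0]) simp_all
  also have "\<dots> = (\<integral>\<^sup>+x. ennreal (real K ^ CARD('d) * gaussian_density v (real K *\<^sub>R x)) * indicator A x \<partial>lborel)"
    by (subst nn_integral_cmult[symmetric]) (simp_all add: ennreal_mult' mult.assoc del: ennreal_power)
  also have "\<dots> = (\<integral>\<^sup>+x. ennreal (gaussian_density (v / (real K)\<^sup>2) x) * indicator A x \<partial>lborel)"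
    using assms K by (simp only: gaussian_density_scale)
  also have "\<dots> = emeasure (gaussian (v / (real K)\<^sup>2)) A"
    by (simp add: gaussian_def emeasure_density)
  finally show "emeasure (rescale K (gaussian v)) A = emeasure (gaussian (v / (real K)\<^sup>2)) A" .
qed (simp add: rescale_def)

text \<open>The stationary variance \<open>v\<close> solves \<open>\<sigma>\<^sup>2 + K * v / K\<^sup>2 = v\<close>: the convolution power multiplies the
  variance by \<open>K\<close>, the rescaling divides it by \<open>K\<^sup>2\<close>, and the noise adds \<open>\<sigma>\<^sup>2\<close>.\<close>

lemma T_op_rho_inf:
  assumes "K \<ge> 2" "\<sigma> > 0"
  shows "T_op K \<sigma> (rho_inf K \<sigma>) = (rho_inf K \<sigma> :: (real^'d) measure)"
proof -
  define v where "v = real K / (real K - 1) * \<sigma>\<^sup>2"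
  have v: "v > 0" using assms by (simp add: v_def)
  have "T_op K \<sigma> (gaussian v) = (gaussian (\<sigma>\<^sup>2 + real K * v / (real K)\<^sup>2) :: (real^'d) measure)"
    using assms v by (simp add: T_op_def conv_power_gaussian rescale_gaussian gaussian_convolution)
  also have "\<sigma>\<^sup>2 + real K * v / (real K)\<^sup>2 = v"
    using assms by (simp add: v_def divide_simps power2_eq_square) (simp add: algebra_simps)
  finally show ?thesis by (simp add: rho_inf_def v_def)
qed

text \<open>The first moment is dominated by the mass of a wider Gaussian: a linear factor is absorbed
  by half of the exponent, at the price of doubling the variance.\<close>

lemma integrable_gaussian_id:
  assumes "v > 0"
  shows "integrable (gaussian v) (\<lambda>x::real^'d. x)"
proof (rule integrableI_bounded)
  define C where "C = max 1 v * (2::real) powr (real CARD('d) / 2)"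
  have bound: "gaussian_density v x * norm x \<le> C * gaussian_density (2 * v) x" for x :: "real^'d"
  proof -
    define t where "t = norm x"
    have "0 \<le> (t - 2 * v)\<^sup>2" by simp
    \<comment> \<open>Weighted so that \<open>t\<^sup>2\<close> gets the coefficient \<open>1 / (4 v)\<close>, half of the one in the exponent.\<close>
    then have "t \<le> v + t\<^sup>2 / (4 * v)"
      using assms by (simp add: field_simps power2_eq_square)
    also have "\<dots> \<le> max 1 v * (1 + t\<^sup>2 / (4 * v))"
      using mult_right_mono[of 1 "max 1 v" "t\<^sup>2 / (4 * v)"] assms by (simp add: distrib_left)
    also have "\<dots> \<le> max 1 v * exp (t\<^sup>2 / (4 * v))"
      by (intro mult_left_mono exp_ge_add_one_self) simp
    finally have t: "t \<le> max 1 v * exp (t\<^sup>2 / (4 * v))" .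
    have "exp (- t\<^sup>2 / (2 * v)) * t \<le> exp (- t\<^sup>2 / (2 * v)) * (max 1 v * exp (t\<^sup>2 / (4 * v)))"
      by (intro mult_left_mono t) simp
    also have "\<dots> = max 1 v * exp (- t\<^sup>2 / (2 * (2 * v)))"
      using assms by (simp add: exp_add[symmetric] mult_ac)
    finally have e: "exp (- t\<^sup>2 / (2 * v)) * t \<le> max 1 v * exp (- t\<^sup>2 / (2 * (2 * v)))" .
    have p: "(2 * pi * (2 * v)) powr (- real CARD('d) / 2) * 2 powr (real CARD('d) / 2)
        = (2 * pi * v) powr (- real CARD('d) / 2)"
    proof -
      have "(2 * pi * (2 * v)) powr (- real CARD('d) / 2)
          = (2 * pi * v) powr (- real CARD('d) / 2) * 2 powr (- real CARD('d) / 2)"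
        by (simp only: powr_mult[symmetric]) (simp add: mult_ac)
      moreover have "2 powr (- real CARD('d) / 2) * 2 powr (real CARD('d) / 2) = (1::real)"
        by (simp add: powr_add[symmetric])
      ultimately show ?thesis by (simp add: mult.assoc)
    qed
    have "gaussian_density v x * norm x
        = (2 * pi * v) powr (- real CARD('d) / 2) * (exp (- t\<^sup>2 / (2 * v)) * t)"
      by (simp add: gaussian_density_def t_def)
    also have "\<dots> \<le> (2 * pi * v) powr (- real CARD('d) / 2) * (max 1 v * exp (- t\<^sup>2 / (2 * (2 * v))))"
      by (intro mult_left_mono e) simp
    also have "\<dots> = C * gaussian_density (2 * v) x"
      unfolding p[symmetric] by (simp add: gaussian_density_def t_def C_def mult_ac)
    finally show ?thesis .
  qed
  have C: "C \<ge> 0" by (simp add: C_def)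
  have "(\<integral>\<^sup>+x. ennreal (norm x) \<partial>(gaussian v :: (real^'d) measure))
      = (\<integral>\<^sup>+x. ennreal (gaussian_density v x * norm x) \<partial>(lborel :: (real^'d) measure))"
    by (simp add: nn_integral_gaussian ennreal_mult')
  also have "\<dots> \<le> (\<integral>\<^sup>+x. ennreal (C * gaussian_density (2 * v) x) \<partial>(lborel :: (real^'d) measure))"
    by (intro nn_integral_mono ennreal_leI bound)
  also have "\<dots> = ennreal C"
    using assms C by (simp add: ennreal_mult' nn_integral_cmult nn_integral_gaussian_density)
  finally show "(\<integral>\<^sup>+x. ennreal (norm x) \<partial>(gaussian v :: (real^'d) measure)) < \<infinity>"
    using le_less_trans by fastforce
qed simp

lemma distr_gaussian_uminus:
  "distr (gaussian v) borel uminus = (gaussian v :: (real^'d) measure)"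
proof (rule measure_eqI)
  fix A :: "(real^'d) set" assume "A \<in> sets (distr (gaussian v) borel uminus)"
  then have [measurable]: "A \<in> sets borel" by simp
  have "emeasure (distr (gaussian v) borel uminus) A
      = (\<integral>\<^sup>+x. indicator A x \<partial>distr (gaussian v) borel uminus)"
    by simp
  also have "\<dots> = (\<integral>\<^sup>+x. ennreal (gaussian_density v x) * indicator A (- x) \<partial>lborel)"
    by (subst nn_integral_distr) (simp_all add: nn_integral_gaussian)
  also have "\<dots> = (\<integral>\<^sup>+x. ennreal (gaussian_density v (- x)) * indicator A x \<partial>lborel)"
    by (subst nn_integral_lborel_affine[of _ "-1" 0]) simp_all
  also have "\<dots> = emeasure (gaussian v) A"
    by (simp add: gaussian_def emeasure_density gaussian_density_def)
  finally show "emeasure (distr (gaussian v) borel uminus) A = emeasure (gaussian v) A" .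
qed simp

text \<open>The law is invariant under reflection, so its mean equals its own negative.\<close>

lemma integral_gaussian_id:
  "integral\<^sup>L (gaussian v) (\<lambda>x::real^'d. x) = 0"
proof -
  have "integral\<^sup>L (gaussian v) (\<lambda>x::real^'d. x) = integral\<^sup>L (distr (gaussian v) borel uminus) (\<lambda>x::real^'d. x)"
    by (simp add: distr_gaussian_uminus)
  also have "\<dots> = - integral\<^sup>L (gaussian v) (\<lambda>x::real^'d. x)"
    by (subst integral_distr) simp_all
  finally show ?thesis
    by (simp add: vec_eq_iff)
qed

section \<open>Couplings\<close>

abbreviation transport_cost :: "((real^'d) \<times> (real^'d)) measure \<Rightarrow> ennreal" where
  "transport_cost \<gamma> \<equiv> \<integral>\<^sup>+(x, y). ennreal ((norm (x - y))\<^sup>2) \<partial>\<gamma>"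

lemma borel_measurable_transport_cost [measurable]:
  "(\<lambda>(x, y). ennreal ((norm (x - y))\<^sup>2)) \<in> borel_measurable (borel :: ((real^'d) \<times> (real^'d)) measure)"
  unfolding borel_prod[symmetric] by measurable

lemma fst_snd_borel_measurable [measurable]:
  "fst \<in> borel_measurable (borel :: ('a::second_countable_topology \<times> 'b::second_countable_topology) measure)"
  "snd \<in> borel_measurable (borel :: ('a::second_countable_topology \<times> 'b::second_countable_topology) measure)"
  unfolding borel_prod[symmetric] by measurable

lemma W2_sq_le: "\<gamma> \<in> couplings \<mu> \<nu> \<Longrightarrow> W2_sq \<mu> \<nu> \<le> transport_cost \<gamma>"
  unfolding W2_sq_def by (rule INF_lower)

lemma prob_space_convolution:
  fixes M N :: "'a::ordered_euclidean_space measure"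
  assumes "prob_space M" "prob_space N" and [measurable_cong]: "sets M = sets borel" "sets N = sets borel"
  shows "prob_space (M \<star> N)"
proof -
  interpret M: prob_space M by fact
  interpret N: prob_space N by fact
  interpret pair_prob_space M N ..
  show ?thesis unfolding convolution_def by (rule prob_space_distr) measurable
qed

lemma distr_convolution_additive:
  fixes M N :: "'a::ordered_euclidean_space measure" and f :: "'a \<Rightarrow> 'b::ordered_euclidean_space"
  assumes "prob_space M" "prob_space N" and [measurable_cong]: "sets M = sets borel" "sets N = sets borel"
    and [measurable]: "f \<in> borel_measurable borel" and add: "\<And>x y. f (x + y) = f x + f y"
  shows "distr (M \<star> N) borel f = (distr M borel f \<star> distr N borel f)"
proof -
  interpret N': prob_space "distr N borel f" using assms(2) by (rule prob_space.prob_space_distr) simp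
  have "distr M borel f \<Otimes>\<^sub>M distr N borel f = distr (M \<Otimes>\<^sub>M N) (borel \<Otimes>\<^sub>M borel) (\<lambda>(x, y). (f x, f y))"
    by (rule pair_measure_distr) (simp_all add: N'.sigma_finite_measure)
  then show ?thesis
    unfolding convolution_def
    by (simp add: distr_distr comp_def split_beta add)
qed

text \<open>The coordinate projections are additive, so the marginals of a convolution are the
  convolutions of the marginals. This is the law of \<open>(X + X', Y + Y')\<close> for independent pairs
  \<open>(X, Y)\<close> and \<open>(X', Y')\<close>.\<close>

lemma convolution_in_couplings:
  assumes "\<gamma> \<in> couplings \<mu> \<nu>" "\<gamma>' \<in> couplings \<mu>' \<nu>'"
  shows "(\<gamma> \<star> \<gamma>') \<in> couplings (\<mu> \<star> \<mu>') (\<nu> \<star> \<nu>')"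
proof -
  have "prob_space \<gamma>" "sets \<gamma> = sets borel" "prob_space \<gamma>'" "sets \<gamma>' = sets borel"
    "distr \<gamma> borel fst = \<mu>" "distr \<gamma> borel snd = \<nu>" "distr \<gamma>' borel fst = \<mu>'" "distr \<gamma>' borel snd = \<nu>'"
    using assms by (auto simp: couplings_def prob_measures_def)
  then show ?thesis
    by (auto simp: couplings_def prob_measures_def prob_space_convolution distr_convolution_additive)
qed

text \<open>Expand the square: the cross term \<open>2 * (Z \<bullet> u)\<close> has expectation zero.\<close>

lemma (in prob_space) nn_integral_norm_add_squared_centred:
  fixes Z :: "'a \<Rightarrow> 'b::euclidean_space"
  assumes [measurable]: "Z \<in> borel_measurable M" and int: "integrable M Z" "integral\<^sup>L M Z = 0"
    and fin: "(\<integral>\<^sup>+p. ennreal ((norm (Z p))\<^sup>2) \<partial>M) < \<infinity>"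
  shows "(\<integral>\<^sup>+p. ennreal ((norm (Z p + u))\<^sup>2) \<partial>M)
       = (\<integral>\<^sup>+p. ennreal ((norm (Z p))\<^sup>2) \<partial>M) + ennreal ((norm u)\<^sup>2)"
proof -
  have sq: "integrable M (\<lambda>p. (norm (Z p))\<^sup>2)"
    using fin by (intro integrableI_bounded) simp_all
  have eq: "(norm (Z p + u))\<^sup>2 = (norm (Z p))\<^sup>2 + 2 * (Z p \<bullet> u) + (norm u)\<^sup>2" for p
    by (simp add: power2_norm_eq_inner inner_add inner_commute)
  have lin: "integrable M (\<lambda>p. Z p \<bullet> u)" "(\<integral>p. Z p \<bullet> u \<partial>M) = 0"
    using int by simp_all
  have "(\<integral>\<^sup>+p. ennreal ((norm (Z p + u))\<^sup>2) \<partial>M) = ennreal (\<integral>p. (norm (Z p + u))\<^sup>2 \<partial>M)"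
  proof (rule nn_integral_eq_integral)
    show "integrable M (\<lambda>p. (norm (Z p + u))\<^sup>2)"
      unfolding eq using sq lin(1) by simp
  qed simp
  also have "(\<integral>p. (norm (Z p + u))\<^sup>2 \<partial>M) = (\<integral>p. (norm (Z p))\<^sup>2 \<partial>M) + (norm u)\<^sup>2"
    unfolding eq using sq lin by (simp add: prob_space)
  also have "ennreal \<dots> = ennreal (\<integral>p. (norm (Z p))\<^sup>2 \<partial>M) + ennreal ((norm u)\<^sup>2)"
    by simp
  also have "ennreal (\<integral>p. (norm (Z p))\<^sup>2 \<partial>M) = (\<integral>\<^sup>+p. ennreal ((norm (Z p))\<^sup>2) \<partial>M)"
    using sq by (intro nn_integral_eq_integral[symmetric]) auto
  finally show ?thesis .
qed

text \<open>The difference \<open>Z = X - Y\<close> of the first pair is centred because \<open>\<mu>\<close> and \<open>\<nu>\<close> have the same mean.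
  With the second pair fixed, the cross term integrates to zero over the first pair. The
  assumptions on means and finiteness concern the first pair alone, so an induction that adds
  one factor at a time need not track the moments of the accumulated sum.\<close>

lemma transport_cost_convolution:
  fixes \<gamma> \<gamma>' :: "((real^'d) \<times> (real^'d)) measure"
  assumes \<gamma>: "\<gamma> \<in> couplings \<mu> \<nu>" and \<gamma>': "\<gamma>' \<in> couplings \<mu>' \<nu>'"
    and int: "integrable \<mu> (\<lambda>x. x)" "integrable \<nu> (\<lambda>x. x)"
    and mean: "integral\<^sup>L \<mu> (\<lambda>x. x) = integral\<^sup>L \<nu> (\<lambda>x. x)"
    and fin: "transport_cost \<gamma> < \<infinity>"
  shows "transport_cost (\<gamma> \<star> \<gamma>') = transport_cost \<gamma> + transport_cost \<gamma>'"
proof -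
  have "prob_space \<gamma>" "prob_space \<gamma>'"
    and s[measurable_cong]: "sets \<gamma> = sets borel" "sets \<gamma>' = sets borel"
    and \<mu>: "\<mu> = distr \<gamma> borel fst" and \<nu>: "\<nu> = distr \<gamma> borel snd"
    using \<gamma> \<gamma>' by (auto simp: couplings_def prob_measures_def)
  interpret G: prob_space \<gamma> by fact
  interpret G': prob_space \<gamma>' by fact
  interpret pair_prob_space \<gamma> \<gamma>' ..
  have m: "fst \<in> \<gamma> \<rightarrow>\<^sub>M borel" "snd \<in> \<gamma> \<rightarrow>\<^sub>M borel" by measurable
  have int_fst: "integrable \<gamma> fst" and int_snd: "integrable \<gamma> snd"
    using integrable_distr[OF m(1) int(1)[unfolded \<mu>]] integrable_distr[OF m(2) int(2)[unfolded \<nu>]]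
    by this
  have mean': "integral\<^sup>L \<gamma> fst = integral\<^sup>L \<gamma> snd"
    using mean unfolding \<mu> \<nu> integral_distr[OF m(1) measurable_ident_sets[OF refl]]
      integral_distr[OF m(2) measurable_ident_sets[OF refl]] .
  let ?Z = "\<lambda>p::(real^'d) \<times> (real^'d). fst p - snd p"
  have Z: "integrable \<gamma> ?Z" "integral\<^sup>L \<gamma> ?Z = 0"
    using int_fst int_snd mean' by simp_all
  have [measurable]: "?Z \<in> borel_measurable borel" by measurable
  have "transport_cost (\<gamma> \<star> \<gamma>') = (\<integral>\<^sup>+p. \<integral>\<^sup>+q. ennreal ((norm (?Z p + ?Z q))\<^sup>2) \<partial>\<gamma>' \<partial>\<gamma>)"
    by (subst nn_integral_convolution)
       (simp_all add: s G.finite_measure_axioms G'.finite_measure_axioms split_beta add_diff_add)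
  also have "\<dots> = (\<integral>\<^sup>+q. \<integral>\<^sup>+p. ennreal ((norm (?Z p + ?Z q))\<^sup>2) \<partial>\<gamma> \<partial>\<gamma>')"
    by (rule Fubini'[symmetric]) measurable
  also have "\<dots> = (\<integral>\<^sup>+q. transport_cost \<gamma> + ennreal ((norm (?Z q))\<^sup>2) \<partial>\<gamma>')"
    using fin Z by (subst G.nn_integral_norm_add_squared_centred) (simp_all add: split_beta')
  also have "\<dots> = transport_cost \<gamma> + transport_cost \<gamma>'"
    by (subst nn_integral_add) (simp_all add: G'.emeasure_space_1 split_beta')
  finally show ?thesis .
qed

text \<open>The infima are taken one after the other; a finite summand is moved to the other side by
  subtraction, and an infinite one makes the bound trivial.\<close>

lemma le_INF_add_INF_ennreal:
  fixes c :: ennreal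
  assumes "\<And>i j. i \<in> I \<Longrightarrow> j \<in> J \<Longrightarrow> c \<le> f i + g j"
  shows "c \<le> (INF i\<in>I. f i) + (INF j\<in>J. g j)"
proof -
  have *: "c \<le> a + (INF j\<in>J. h j)" if "\<And>j. j \<in> J \<Longrightarrow> c \<le> a + h j"
    for a :: ennreal and h :: "'z \<Rightarrow> ennreal" and J
  proof (cases "a = \<top>")
    case False
    then have "c - a \<le> (INF j\<in>J. h j)"
      using that by (intro INF_greatest) (simp add: ennreal_minus_le_iff)
    then show ?thesis using False by (simp add: ennreal_minus_le_iff)
  qed simp
  have "c \<le> (INF j\<in>J. g j) + f i" if "i \<in> I" for i
    using *[of J "f i" g] assms that by (simp add: add.commute)
  from *[of I _ f, OF this] show ?thesis by (simp add: add.commute)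
qed

text \<open>Optimising separately over couplings of both pairs. Couplings of infinite cost make the bound
  trivial, and the others satisfy the additivity of costs.\<close>

lemma W2_sq_convolution_le:
  fixes \<mu> \<nu> \<mu>' \<nu>' :: "(real^'d) measure"
  assumes "integrable \<mu> (\<lambda>x. x)" "integrable \<nu> (\<lambda>x. x)"
    and "integral\<^sup>L \<mu> (\<lambda>x. x) = integral\<^sup>L \<nu> (\<lambda>x. x)"
  shows "W2_sq (\<mu> \<star> \<mu>') (\<nu> \<star> \<nu>') \<le> W2_sq \<mu> \<nu> + W2_sq \<mu>' \<nu>'"
  unfolding W2_sq_def[of \<mu> \<nu>] W2_sq_def[of \<mu>' \<nu>']
proof (rule le_INF_add_INF_ennreal)
  fix \<gamma> \<gamma>' assume \<gamma>: "\<gamma> \<in> couplings \<mu> \<nu>" "\<gamma>' \<in> couplings \<mu>' \<nu>'"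
  show "W2_sq (\<mu> \<star> \<mu>') (\<nu> \<star> \<nu>') \<le> transport_cost \<gamma> + transport_cost \<gamma>'"
  proof (cases "transport_cost \<gamma> < \<infinity>")
    case True
    then show ?thesis
      using W2_sq_le[OF convolution_in_couplings[OF \<gamma>]] transport_cost_convolution[OF \<gamma> assms] by simp
  next
    case False
    then have "transport_cost \<gamma> = \<top>" by (simp add: less_top[symmetric])
    then show ?thesis by simp
  qed
qed

lemma W2_sq_conv_power_le:
  fixes \<mu> \<nu> :: "(real^'d) measure"
  assumes "integrable \<mu> (\<lambda>x. x)" "integrable \<nu> (\<lambda>x. x)"
    and "integral\<^sup>L \<mu> (\<lambda>x. x) = integral\<^sup>L \<nu> (\<lambda>x. x)" and "K \<ge> 1"
  shows "W2_sq (conv_power K \<mu>) (conv_power K \<nu>) \<le> of_nat K * W2_sq \<mu> \<nu>"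
  using assms(4)
proof (induction K rule: dec_induct)
  case base
  show ?case using conv_power_1[of \<mu>] conv_power_1[of \<nu>] by simp
next
  case (step K)
  have "W2_sq (conv_power (Suc K) \<mu>) (conv_power (Suc K) \<nu>)
      \<le> W2_sq \<mu> \<nu> + W2_sq (conv_power K \<mu>) (conv_power K \<nu>)"
    using step W2_sq_convolution_le[OF assms(1-3)] by (simp add: conv_power_Suc)
  also have "\<dots> \<le> W2_sq \<mu> \<nu> + of_nat K * W2_sq \<mu> \<nu>"
    by (intro add_left_mono step.IH)
  finally show ?case by (simp add: distrib_right)
qed

text \<open>Push a coupling forward under the rescaling of both components. The factor stands on the left
  so that the bound can be checked against one coupling at a time.\<close>

lemma W2_sq_rescale_le:
  fixes \<mu> \<nu> :: "(real^'d) measure"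
  assumes "K \<ge> 1"
  shows "ennreal ((real K)\<^sup>2) * W2_sq (rescale K \<mu>) (rescale K \<nu>) \<le> W2_sq \<mu> \<nu>"
  unfolding W2_sq_def[of \<mu> \<nu>]
proof (rule INF_greatest)
  fix \<gamma> assume \<gamma>: "\<gamma> \<in> couplings \<mu> \<nu>"
  then have "prob_space \<gamma>" and s[measurable_cong]: "sets \<gamma> = sets borel"
    and \<mu>: "\<mu> = distr \<gamma> borel fst" and \<nu>: "\<nu> = distr \<gamma> borel snd"
    by (auto simp: couplings_def prob_measures_def)
  interpret prob_space \<gamma> by fact
  let ?\<gamma> = "distr \<gamma> borel (\<lambda>p. p /\<^sub>R real K)"
  have "?\<gamma> \<in> couplings (rescale K \<mu>) (rescale K \<nu>)"
    unfolding couplings_def prob_measures_def rescale_def \<mu> \<nu>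
    by (auto intro!: prob_space_distr simp: distr_distr comp_def)
  then have "W2_sq (rescale K \<mu>) (rescale K \<nu>) \<le> transport_cost ?\<gamma>"
    by (rule W2_sq_le)
  then have "ennreal ((real K)\<^sup>2) * W2_sq (rescale K \<mu>) (rescale K \<nu>)
      \<le> ennreal ((real K)\<^sup>2) * transport_cost ?\<gamma>"
    by (rule mult_left_mono) simp
  also have "\<dots> = (\<integral>\<^sup>+p. ennreal ((real K)\<^sup>2) * ennreal ((norm (fst p /\<^sub>R real K - snd p /\<^sub>R real K))\<^sup>2) \<partial>\<gamma>)"
    by (subst nn_integral_distr) (simp_all add: nn_integral_cmult split_beta)
  also have "\<dots> = transport_cost \<gamma>"
  proof (intro nn_integral_cong)
    fix p :: "(real^'d) \<times> (real^'d)"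
    have "norm (fst p /\<^sub>R real K - snd p /\<^sub>R real K) = norm (fst p - snd p) / real K"
      by (simp add: scaleR_diff_right[symmetric] divide_inverse mult.commute)
    then show "ennreal ((real K)\<^sup>2) * ennreal ((norm (fst p /\<^sub>R real K - snd p /\<^sub>R real K))\<^sup>2)
        = (case p of (x, y) \<Rightarrow> ennreal ((norm (x - y))\<^sup>2))"
      using assms by (simp add: ennreal_mult'[symmetric] power_divide split_beta)
  qed
  finally show "ennreal ((real K)\<^sup>2) * W2_sq (rescale K \<mu>) (rescale K \<nu>) \<le> transport_cost \<gamma>" .
qed

lemma W2_sq_refl:
  fixes \<mu> :: "(real^'d) measure"
  assumes "\<mu> \<in> prob_measures"
  shows "W2_sq \<mu> \<mu> = 0"
proof -
  have "prob_space \<mu>" and s[measurable_cong]: "sets \<mu> = sets borel"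
    using assms by (auto simp: prob_measures_def)
  interpret prob_space \<mu> by fact
  have [measurable]: "(\<lambda>x. (x, x)) \<in> borel_measurable (borel :: (real^'d) measure)"
    unfolding borel_prod[symmetric] by measurable
  let ?\<gamma> = "distr \<mu> borel (\<lambda>x. (x, x))"
  have "distr \<mu> borel (\<lambda>x. x) = \<mu>"
    using s by (intro distr_id2) simp
  then have "?\<gamma> \<in> couplings \<mu> \<mu>"
    unfolding couplings_def prob_measures_def
    by (auto intro!: prob_space_distr simp: distr_distr comp_def)
  moreover have "transport_cost ?\<gamma> = 0"
    by (subst nn_integral_distr) simp_all
  ultimately show ?thesis
    using W2_sq_le by fastforce
qed

section \<open>The contraction\<close>

text \<open>The factors are \<open>K\<close> from the convolution power and \<open>1 / K\<^sup>2\<close> from the rescaling; the common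
  Gaussian noise is coupled to itself along the diagonal and contributes nothing.\<close>

lemma W2_sq_T_op_le:
  fixes \<mu> \<nu> :: "(real^'d) measure"
  assumes "integrable \<mu> (\<lambda>x. x)" "integrable \<nu> (\<lambda>x. x)"
    and "integral\<^sup>L \<mu> (\<lambda>x. x) = integral\<^sup>L \<nu> (\<lambda>x. x)" and K: "K \<ge> 1" and \<sigma>: "\<sigma> > 0"
  shows "W2_sq (T_op K \<sigma> \<mu>) (T_op K \<sigma> \<nu>) \<le> ennreal (1 / real K) * W2_sq \<mu> \<nu>"
proof -
  let ?R = "W2_sq (rescale K (conv_power K \<mu>)) (rescale K (conv_power K \<nu>))"
  have "W2_sq (T_op K \<sigma> \<mu>) (T_op K \<sigma> \<nu>) \<le> W2_sq (gaussian (\<sigma>\<^sup>2)) (gaussian (\<sigma>\<^sup>2) :: (real^'d) measure) + ?R"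
    unfolding T_op_def using \<sigma> by (intro W2_sq_convolution_le integrable_gaussian_id) auto
  also have "\<dots> = ?R"
    using \<sigma> by (simp add: W2_sq_refl gaussian_in_prob_measures)
  also have "\<dots> = ennreal (1 / (real K)\<^sup>2) * (ennreal ((real K)\<^sup>2) * ?R)"
    using K by (simp add: mult.assoc[symmetric] ennreal_mult'[symmetric] del: ennreal_power)
  also have "\<dots> \<le> ennreal (1 / (real K)\<^sup>2) * (of_nat K * W2_sq \<mu> \<nu>)"
    using W2_sq_rescale_le[OF K] W2_sq_conv_power_le[OF assms(1-3) K]
    by (intro mult_left_mono) (auto intro: order_trans)
  also have "\<dots> = ennreal (1 / (real K)\<^sup>2 * real K) * W2_sq \<mu> \<nu>"
    by (simp only: ennreal_mult'' ennreal_of_nat_eq_real_of_nat mult.assoc of_nat_0_le_iff)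
  also have "1 / (real K)\<^sup>2 * real K = 1 / real K"
    using K by (simp add: power2_eq_square)
  finally show ?thesis .
qed

theorem theorem2:
  fixes K :: nat and \<sigma> :: real and \<rho> :: "nat \<Rightarrow> (real^'d) measure"
  assumes "K \<ge> 2" and "\<sigma> > 0"
    and "\<rho> 0 \<in> prob_measures"
    and "\<And>n. \<rho> (Suc n) = T_op K \<sigma> (\<rho> n)"
    and "\<And>n. integrable (\<rho> n) (\<lambda>x. x)"
    and "\<And>n. integral\<^sup>L (\<rho> n) (\<lambda>x. x) = 0"
  shows "(\<forall>n. W2_sq (\<rho> (Suc n)) (rho_inf K \<sigma>)
              \<le> ennreal (1 / real K) * W2_sq (\<rho> n) (rho_inf K \<sigma>))
       \<and> (W2_sq (\<rho> 0) (rho_inf K \<sigma>) < \<infinity>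
            \<longrightarrow> (\<lambda>n. W2_sq (\<rho> n) (rho_inf K \<sigma>)) \<longlonglongrightarrow> 0)"
proof -
  let ?W = "\<lambda>n. W2_sq (\<rho> n) (rho_inf K \<sigma>)"
  have "real K / (real K - 1) * \<sigma>\<^sup>2 > 0" using assms(1,2) by simp
  then have inf: "integrable (rho_inf K \<sigma>) (\<lambda>x::real^'d. x)" "integral\<^sup>L (rho_inf K \<sigma>) (\<lambda>x::real^'d. x) = 0"
    unfolding rho_inf_def by (rule integrable_gaussian_id, simp add: integral_gaussian_id)
  have step: "?W (Suc n) \<le> ennreal (1 / real K) * ?W n" for n
    using W2_sq_T_op_le[of "\<rho> n" "rho_inf K \<sigma>" K \<sigma>] assms inf
    by (simp add: T_op_rho_inf)
  have geometric: "?W n \<le> ennreal ((1 / real K) ^ n) * ?W 0" for n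
  proof (induction n)
    case (Suc n)
    have "?W (Suc n) \<le> ennreal (1 / real K) * (ennreal ((1 / real K) ^ n) * ?W 0)"
      using step[of n] Suc.IH by (meson mult_left_mono order_trans zero_le)
    also have "\<dots> = ennreal ((1 / real K) ^ Suc n) * ?W 0"
      by (simp only: power_Suc mult.assoc[symmetric]) (simp add: ennreal_mult'[symmetric] del: ennreal_power)
    finally show ?case .
  qed simp
  have "?W \<longlonglongrightarrow> 0" if "?W 0 < \<infinity>"
  proof (rule tendsto_sandwich[OF _ _ tendsto_const])
    have "(\<lambda>n. (1 / real K) ^ n) \<longlonglongrightarrow> 0"
      using assms(1) by (intro LIMSEQ_power_zero) simp
    then have "(\<lambda>n. ennreal ((1 / real K) ^ n) * ?W 0) \<longlonglongrightarrow> ennreal 0 * ?W 0"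
      using that by (intro tendsto_mult_ennreal tendsto_ennrealI tendsto_const) auto
    then show "(\<lambda>n. ennreal ((1 / real K) ^ n) * ?W 0) \<longlonglongrightarrow> 0" by simp
  qed (use geometric in auto)
  with step show ?thesis by blast
qed

end
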